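(* Let $M,T,J\geq 1$ be integers with $MT=J$, and consider the (busy) open-shop scheduling problem $\mathrm{OSSP}(M,T,J)$ with costs $\omega_{mtj}\in\mathbb{R}$. Let $|\iota\rangle$ be a feasible computational basis state, i.e. $|\iota\rangle=|\boldsymbol{z}\rangle$ for some $\boldsymbol{z}\in S$. Then there exist parameter values $\vec\beta\in[0,\tfrac{\pi}{2}]^{J(J-1)^2/2}$ such that $U(\vec\beta)|\iota\rangle$ is, up to a global phase, a computational basis state $|\boldsymbol{z}^*\rangle$ with $\boldsymbol{z}^*\in S_{\min}$ an optimal solution. In particular, measuring $U(\vec\beta)|\iota\rangle$ in the computational basis returns an optimal solution with probability $1$.
   Context: Notation: $[n]=\{1,\ldots,n\}$. $\mathrm{OSSP}(M,T,J)$ has bit strings $\boldsymbol{z}=(z_{mtj})\in\{0,1\}^{N}$, $N=MTJ$, indexed by $(m,t,j)\in[M]\times[T]\times[J]$. The solution set $S$ consists of all $\boldsymbol{z}$ with $\sum_{m=1}^M\sum_{t=1}^T z_{mtj}=1$ for all $j\in[J]$ and $\sum_{j=1}^J z_{mtj}\leq 1$ for all $(m,t)\in[M]\times[T]$. The objective function, to be minimized over $S$, is $f(\boldsymbol{z})=\sum_{m,t,j}\omega_{mtj}z_{mtj}$, and $S_{\min}=\{\boldsymbol{z}\in S: f(\boldsymbol{z})=\min_{\boldsymbol{z}'\in S}f(\boldsymbol{z}')\}$ is the set of optimal solutions. The $N$-qubit space is $\mathcal{H}=\mathbb{C}^{2^N}$ with computational basis $\{|\boldsymbol{z}\rangle:\boldsymbol{z}\in\{0,1\}^N\}$,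 the qubits being indexed by $[M]\times[T]\times[J]$. The position blocks are the sets $\{m\}\times\{t\}\times[J]$, $(m,t)\in[M]\times[T]$; since $MT=J$ there are $J$ of them, and we enumerate them by $p\in[J]$. Each contains $J$ qubits, labeled by the job coordinate. For $i\in[J-1]$ let $\mathrm{SWAP}^{(p)}_{(i,i+1)}$ be the unitary on $\mathcal{H}$ that interchanges the $i$th and the $(i+1)$th qubit of the $p$th position block, and set $$B_i:=\prod_{p=1}^{J}\mathrm{SWAP}^{(p)}_{(i,i+1)},$$ a Hermitian operator. The parameterized circuit with parameters $\vec\beta=(\beta_{k_i})_{1\leq k\leq J(J-1)/2,\,1\leq i\leq J-1}$, hence $J(J-1)^2/2$ parameters in total, is $$U(\vec\beta)=\prod_{k=1}^{J(J-1)/2}\Big(e^{-\mathrm{i}\beta_{k_1}B_1}\cdots e^{-\mathrm{i}\beta_{k_{J-1}}B_{J-1}}\Big),$$ where $\mathrm{i}$ is the imaginary unit. *)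

theory Defs
  imports "HOL-Analysis.Analysis"
begin

text \<open>
  The machines, time slots and jobs are the elements of finite types \<open>'m\<close>, \<open>'t\<close>, \<open>'j\<close>, so that
  \<open>M\<close>, \<open>T\<close>, \<open>J\<close> are \<open>CARD('m)\<close>, \<open>CARD('t)\<close>, \<open>CARD('j)\<close>, and a bit string is a truth-value labelling
  of \<open>'m \<times> 't \<times> 'j\<close>.  Bit strings form a finite type with \<open>2 ^ (M * T * J)\<close> elements, which is
  the index type of the state space.
\<close>

type_synonym ('m, 't, 'j) bits = "'m \<times> 't \<times> 'j \<Rightarrow> bool"
type_synonym ('m, 't, 'j) state = "complex ^ ('m, 't, 'j) bits"
type_synonym ('m, 't, 'j) operator = "complex ^ ('m, 't, 'j) bits ^ ('m, 't, 'j) bits"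

definition ossp_solutions :: "('m::finite, 't::finite, 'j::finite) bits set" where
  "ossp_solutions =
     {z. (\<forall>j. (\<Sum>m\<in>UNIV. \<Sum>t\<in>UNIV. of_bool (z (m, t, j))) = (1::nat)) \<and>
         (\<forall>m t. (\<Sum>j\<in>UNIV. of_bool (z (m, t, j))) \<le> (1::nat))}"

definition ossp_cost ::
  "('m \<Rightarrow> 't \<Rightarrow> 'j \<Rightarrow> real) \<Rightarrow> ('m::finite, 't::finite, 'j::finite) bits \<Rightarrow> real" where
  "ossp_cost \<omega> z = (\<Sum>m\<in>UNIV. \<Sum>t\<in>UNIV. \<Sum>j\<in>UNIV. \<omega> m t j * of_bool (z (m, t, j)))"

definition ossp_optimal ::
  "('m \<Rightarrow> 't \<Rightarrow> 'j \<Rightarrow> real) \<Rightarrow> ('m::finite, 't::finite, 'j::finite) bits set" where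
  "ossp_optimal \<omega> =
     {z \<in> ossp_solutions. ossp_cost \<omega> z = Min (ossp_cost \<omega> ` ossp_solutions)}"

definition basis_state :: "('m::finite, 't::finite, 'j::finite) bits \<Rightarrow> ('m, 't, 'j) state" where
  "basis_state z = axis z 1"

text \<open>Ordered products: the head of the list is the leftmost factor.\<close>

definition mat_prod :: "('a::semiring_1 ^ 'n ^ 'n) list \<Rightarrow> 'a ^ 'n ^ 'n" where
  "mat_prod As = foldr (**) As (mat 1)"

text \<open>
  \<open>times\<close> on \<open>complex ^ 'n ^ 'n\<close> is the entrywise product, so neither \<open>power\<close> nor the library's
  \<open>exp\<close> gives the matrix exponential.
\<close>

definition mat_exp :: "complex ^ 'n ^ 'n \<Rightarrow> complex ^ 'n ^ 'n" where
  "mat_exp A = (\<Sum>n. (1 / fact n) *\<^sub>R mat_prod (replicate n A))"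

text \<open>
  The unitary that interchanges the qubits \<open>q\<close> and \<open>q'\<close>: it maps the basis state of \<open>x\<close>
  to that of \<open>x (q := x q', q' := x q)\<close>.
\<close>

definition swap_qubits ::
  "'m \<times> 't \<times> 'j \<Rightarrow> 'm \<times> 't \<times> 'j \<Rightarrow> ('m::finite, 't::finite, 'j::finite) operator" where
  "swap_qubits q q' = (\<chi> y x. of_bool (y = x (q := x q', q' := x q)))"

text \<open>
  \<open>pos p\<close> is the \<open>p\<close>-th position block and \<open>job i\<close> the \<open>i\<close>-th job; both enumerations
  are 1-based and are used on \<open>{1..CARD('j)}\<close> only.
\<close>

definition block_swap ::
  "(nat \<Rightarrow> 'm \<times> 't) \<Rightarrow> (nat \<Rightarrow> 'j) \<Rightarrow> nat \<Rightarrow> nat \<Rightarrow>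
   ('m::finite, 't::finite, 'j::finite) operator" where
  "block_swap pos job p i =
     (case pos p of (m, t) \<Rightarrow> swap_qubits (m, t, job i) (m, t, job (Suc i)))"

definition mixer ::
  "(nat \<Rightarrow> 'm \<times> 't) \<Rightarrow> (nat \<Rightarrow> 'j) \<Rightarrow> nat \<Rightarrow> ('m::finite, 't::finite, 'j::finite) operator" where
  "mixer pos job i = mat_prod (map (\<lambda>p. block_swap pos job p i) [1..<CARD('j) + 1])"

definition circuit ::
  "(nat \<Rightarrow> 'm \<times> 't) \<Rightarrow> (nat \<Rightarrow> 'j) \<Rightarrow> (nat \<Rightarrow> nat \<Rightarrow> real) \<Rightarrow>
   ('m::finite, 't::finite, 'j::finite) operator" where
  "circuit pos job \<beta> =
     mat_prod (map (\<lambda>k. mat_prod (map (\<lambda>i.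
         mat_exp (mat (- (\<i> * complex_of_real (\<beta> k i))) ** mixer pos job i))
       [1..<CARD('j)]))
     [1..<CARD('j) * (CARD('j) - 1) div 2 + 1])"

text \<open>Born rule for a measurement of a normalised state in the computational basis.\<close>

definition outcome_prob ::
  "('m::finite, 't::finite, 'j::finite) state \<Rightarrow> ('m, 't, 'j) bits set \<Rightarrow> real" where
  "outcome_prob \<psi> Z = (\<Sum>z\<in>Z. (cmod (\<psi> $ z))\<^sup>2)"

end

theory Submission
  imports Defs "HOL-Combinatorics.Permutations"
begin

text \<open>
  Since \<open>B\<^sub>i\<close> is an involution, \<open>exp (- \<i> \<beta> B\<^sub>i)\<close> is the identity for \<open>\<beta> = 0\<close> and \<open>- \<i> B\<^sub>i\<close> for
  \<open>\<beta> = \<pi> / 2\<close>, so that each gate can be switched off, or made to exchange the jobs \<open>i\<close> and \<open>i + 1\<close>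
  up to a phase.  As \<open>M T = J\<close>, solutions are bijections between jobs and positions, and any two of
  them differ by a permutation of the jobs.  A layer in which exactly the gates \<open>a, \<dots>, n\<close> are
  switched on acts as a cycle that carries \<open>a\<close> to \<open>n + 1\<close>; hence, by induction on \<open>n\<close>, already
  \<open>n\<close> layers produce every permutation of \<open>n + 1\<close> jobs, and \<open>J - 1 \<le> J (J - 1) / 2\<close>.
\<close>

section \<open>The exponential of an involution\<close>

lemma mat_mult_nth [simp]: "(mat a ** X) $ i $ j = a * X $ i $ j"
  for X :: "'a::semiring_1 ^ 'n ^ 'm::finite"
proof -
  have "(mat a ** X) $ i $ j = (\<Sum>k\<in>UNIV. (if i = k then a * X $ k $ j else 0))"
    unfolding matrix_matrix_mult_def mat_def vec_lambda_beta by (intro sum.cong) auto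
  then show ?thesis by simp
qed

lemma mult_mat_nth [simp]: "(X ** mat a) $ i $ j = X $ i $ j * a"
  for X :: "'a::semiring_1 ^ 'n::finite ^ 'm"
proof -
  have "(X ** mat a) $ i $ j = (\<Sum>k\<in>UNIV. (if k = j then X $ i $ k * a else 0))"
    unfolding matrix_matrix_mult_def mat_def vec_lambda_beta by (intro sum.cong) auto
  then show ?thesis by simp
qed

lemma mat_mult_vector: "(mat a ** X) *v v = a *s (X *v v)"
  for X :: "'a::comm_semiring_1 ^ 'n ^ 'm::finite"
  by (simp add: vec_eq_iff matrix_vector_mult_def sum_distrib_left mult.assoc)

lemma mat_prod_Nil [simp]: "mat_prod [] = mat 1"
  by (simp add: mat_prod_def)

lemma mat_prod_Cons [simp]: "mat_prod (A # As) = A ** mat_prod As"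
  by (simp add: mat_prod_def)

text \<open>Scalar matrices commute with \<open>B\<close>, so the scalars collect in front and the
  powers of \<open>B\<close> collapse by parity.\<close>

lemma mat_prod_replicate_involution:
  fixes B :: "complex ^ 'n ^ 'n::finite"
  assumes "B ** B = mat 1"
  shows "mat_prod (replicate n (mat c ** B)) = mat (c ^ n) ** (if even n then mat 1 else B)"
proof (induction n)
  case 0
  show ?case by (simp add: vec_eq_iff)
next
  case (Suc n)
  let ?Y = "if even n then mat 1 else B"
  have comm: "B ** mat (c ^ n) = mat (c ^ n) ** B"
    by (simp add: vec_eq_iff)
  have "(mat c ** B) ** (mat (c ^ n) ** ?Y) = mat c ** ((B ** mat (c ^ n)) ** ?Y)"
    by (simp only: matrix_mul_assoc)
  also have "\<dots> = mat c ** (mat (c ^ n) ** (B ** ?Y))"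
    unfolding comm by (simp only: matrix_mul_assoc)
  also have "\<dots> = mat (c ^ Suc n) ** (if even (Suc n) then mat 1 else B)"
    using assms by (simp add: vec_eq_iff)
  finally show ?case by (simp add: Suc.IH)
qed

text \<open>By parity the exponential series splits into the \<open>cosh\<close> series times the
  identity and the \<open>sinh\<close> series times \<open>B\<close>. Convergence is checked entry
  by entry, where these are scalar series.\<close>

lemma mat_exp_involution:
  fixes B :: "complex ^ 'n ^ 'n::finite"
  assumes "B ** B = mat 1"
  shows "mat_exp (mat c ** B) = mat (cosh c) + mat (sinh c) ** B"
proof -
  have "(\<lambda>n. (1 / fact n) *\<^sub>R mat_prod (replicate n (mat c ** B)))
      sums (mat (cosh c) + mat (sinh c) ** B)"
    unfolding sums_def
  proof (intro vec_tendstoI)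
    fix i j
    let ?I = "mat 1 :: complex ^ 'n ^ 'n"
    have "(\<lambda>n. (if even n then c ^ n /\<^sub>R fact n else 0) * ?I $ i $ j
             + (if even n then 0 else c ^ n /\<^sub>R fact n) * B $ i $ j)
        sums (cosh c * ?I $ i $ j + sinh c * B $ i $ j)"
      by (intro sums_add sums_mult2 cosh_converges sinh_converges)
    also have "(\<lambda>n. (if even n then c ^ n /\<^sub>R fact n else 0) * ?I $ i $ j
             + (if even n then 0 else c ^ n /\<^sub>R fact n) * B $ i $ j)
        = (\<lambda>n. ((1 / fact n) *\<^sub>R mat_prod (replicate n (mat c ** B))) $ i $ j)"
      by (rule ext) (simp add: mat_prod_replicate_involution[OF assms] divide_inverse)
    also have "cosh c * ?I $ i $ j + sinh c * B $ i $ j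
        = (mat (cosh c) + mat (sinh c) ** B) $ i $ j"
      by (simp only: vector_add_component mat_mult_nth) (simp add: mat_def)
    finally show "(\<lambda>n. (\<Sum>k<n. (1 / fact k) *\<^sub>R mat_prod (replicate k (mat c ** B))) $ i $ j)
        \<longlonglongrightarrow> (mat (cosh c) + mat (sinh c) ** B) $ i $ j"
      by (simp add: sums_def)
  qed
  then show ?thesis
    unfolding mat_exp_def by (rule sums_unique[symmetric])
qed

section \<open>Operators that permute the jobs\<close>

text \<open>For a solution seen as a map \<open>s\<close> from jobs to positions, this is
  precomposition: \<open>s\<close> becomes \<open>s \<circ> f\<close>.\<close>

definition relabel :: "('j \<Rightarrow> 'j) \<Rightarrow> ('m, 't, 'j) bits \<Rightarrow> ('m, 't, 'j) bits" where
  "relabel f x = (\<lambda>(m, t, j). x (m, t, f j))"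

lemma relabel_id [simp]: "relabel id x = x"
  by (simp add: relabel_def)

lemma relabel_comp: "relabel f (relabel g x) = relabel (g \<circ> f) x"
  by (auto simp: relabel_def)

text \<open>Contravariant: in a product, the permutation of the leftmost factor is applied to a job first.\<close>

definition implements ::
  "('m::finite, 't::finite, 'j::finite) operator \<Rightarrow> ('j \<Rightarrow> 'j) \<Rightarrow> bool" where
  "implements U f \<longleftrightarrow>
     (\<forall>x. \<exists>c. cmod c = 1 \<and> U *v basis_state x = c *s basis_state (relabel f x))"

lemma implements_mat_1: "implements (mat 1) id"
  unfolding implements_def by (intro allI exI[of _ 1]) simp

lemma implements_mult:
  assumes "implements U f" "implements V g"
  shows "implements (U ** V) (g \<circ> f)"
  unfolding implements_def
proof
  fix x
  obtain d where d: "cmod d = 1" "V *v basis_state x = d *s basis_state (relabel g x)"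
    using assms(2) unfolding implements_def by blast
  obtain c where c: "cmod c = 1"
    "U *v basis_state (relabel g x) = c *s basis_state (relabel f (relabel g x))"
    using assms(1) unfolding implements_def by blast
  have "(U ** V) *v basis_state x = (c * d) *s basis_state (relabel (g \<circ> f) x)"
    by (simp add: matrix_vector_mul_assoc[symmetric] c d vector_scalar_commute
        relabel_comp mult.commute)
  then show "\<exists>c. cmod c = 1 \<and> (U ** V) *v basis_state x = c *s basis_state (relabel (g \<circ> f) x)"
    using c d by (intro exI[of _ "c * d"]) (simp add: norm_mult)
qed

text \<open>\<open>fold\<close> applies the function of the first list entry first, which matches
  the contravariance of \<open>implements\<close>.\<close>

lemma implements_mat_prod:
  assumes "\<And>x. x \<in> set xs \<Longrightarrow> implements (E x) (f x)"
  shows "implements (mat_prod (map E xs)) (fold f xs)"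
  using assms by (induction xs) (simp_all add: implements_mat_1 implements_mult)

lemma mult_basis_state_nth: "(U *v basis_state x) $ y = U $ y $ x"
proof -
  have "(U *v basis_state x) $ y = (\<Sum>k\<in>UNIV. if k = x then U $ y $ k else 0)"
    unfolding matrix_vector_mult_def basis_state_def axis_def vec_lambda_beta
    by (intro sum.cong) auto
  then show ?thesis by simp
qed

lemma swap_qubits_basis_state:
  "swap_qubits q q' *v basis_state x = basis_state (x(q := x q', q' := x q))"
  unfolding vec_eq_iff mult_basis_state_nth
  by (simp add: swap_qubits_def basis_state_def axis_def)

text \<open>Distinct positions give disjoint blocks, so the swaps do not interfere. Arbitrary lists
  of positions are allowed so that induction over the factors applies.\<close>

lemma block_swaps_basis_state:
  assumes "inj_on pos (set ps)" "distinct ps"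
  shows "mat_prod (map (\<lambda>p. block_swap pos job p i) ps) *v basis_state x =
    basis_state (\<lambda>(m, t, j). if (m, t) \<in> pos ` set ps
      then x (m, t, Transposition.transpose (job i) (job (Suc i)) j) else x (m, t, j))"
  using assms
proof (induction ps)
  case Nil
  then show ?case by simp
next
  case (Cons p ps)
  obtain m t where p: "pos p = (m, t)"
    by (cases "pos p")
  \<comment> \<open>The remaining factors leave the block of \<open>p\<close> alone, so
    \<open>y\<close> still agrees with \<open>x\<close> there.\<close>
  have notin: "(m, t) \<notin> pos ` set ps"
    using Cons.prems p by auto
  let ?a = "job i" and ?b = "job (Suc i)"
  define y where "y = (\<lambda>(m, t, j). if (m, t) \<in> pos ` set ps
      then x (m, t, Transposition.transpose ?a ?b j) else x (m, t, j))"
  have "mat_prod (map (\<lambda>p. block_swap pos job p i) ps) *v basis_state x = basis_state y"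
    unfolding y_def using Cons by simp
  then have "mat_prod (map (\<lambda>p. block_swap pos job p i) (p # ps)) *v basis_state x =
      basis_state (y((m, t, ?a) := y (m, t, ?b), (m, t, ?b) := y (m, t, ?a)))"
    by (simp add: matrix_vector_mul_assoc[symmetric] block_swap_def p swap_qubits_basis_state)
  also have "y((m, t, ?a) := y (m, t, ?b), (m, t, ?b) := y (m, t, ?a)) =
      (\<lambda>(m, t, j). if (m, t) \<in> pos ` set (p # ps)
        then x (m, t, Transposition.transpose ?a ?b j) else x (m, t, j))"
  proof (intro ext, clarify)
    fix m' t' j
    show "(y((m, t, ?a) := y (m, t, ?b), (m, t, ?b) := y (m, t, ?a))) (m', t', j) =
      (if (m', t') \<in> pos ` set (p # ps)
        then x (m', t', Transposition.transpose ?a ?b j) else x (m', t', j))"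
      using notin
      by (cases "(m', t') = (m, t)") (auto simp: y_def p Transposition.transpose_def)
  qed
  finally show ?case .
qed

lemma mixer_basis_state:
  fixes pos :: "nat \<Rightarrow> 'm::finite \<times> 't::finite" and job :: "nat \<Rightarrow> 'j::finite"
  assumes "bij_betw pos {1..CARD('j)} UNIV"
  shows "mixer pos job i *v basis_state x =
    basis_state (relabel (Transposition.transpose (job i) (job (Suc i))) x)"
proof -
  have "set [1..<CARD('j) + 1] = {1..CARD('j)}"
    by auto
  then have "inj_on pos (set [1..<CARD('j) + 1])" "pos ` set [1..<CARD('j) + 1] = UNIV"
    using assms by (simp_all only: bij_betw_def)
  then show ?thesis
    unfolding mixer_def by (simp only: block_swaps_basis_state distinct_upt relabel_def) simp
qed

lemma operator_eqI:
  assumes "\<And>x. U *v basis_state x = V *v basis_state x"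
  shows "U = V"
  using assms by (metis vec_eq_iff mult_basis_state_nth)

lemma mixer_involution:
  fixes pos :: "nat \<Rightarrow> 'm::finite \<times> 't::finite" and job :: "nat \<Rightarrow> 'j::finite"
  assumes "bij_betw pos {1..CARD('j)} UNIV"
  shows "mixer pos job i ** mixer pos job i = mat 1"
  by (rule operator_eqI)
    (simp add: matrix_vector_mul_assoc[symmetric] mixer_basis_state[OF assms] relabel_comp)

lemma implements_gate:
  fixes pos :: "nat \<Rightarrow> 'm::finite \<times> 't::finite" and job :: "nat \<Rightarrow> 'j::finite"
  assumes "bij_betw pos {1..CARD('j)} UNIV"
  shows "implements
    (mat_exp (mat (- (\<i> * complex_of_real (if b then pi / 2 else 0))) ** mixer pos job i))
    (if b then Transposition.transpose (job i) (job (Suc i)) else id)"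
proof (cases b)
  case False
  have "mat_exp (mat 0 ** mixer pos job i) = mat 1"
    unfolding mat_exp_involution[OF mixer_involution[OF assms]] by (simp add: vec_eq_iff)
  with False show ?thesis
    by (simp add: implements_mat_1)
next
  case True
  \<comment> \<open>At this angle the \<open>cosh\<close> term vanishes and \<open>sinh\<close> is
    \<open>- \<i>\<close>: only the mixer survives, with phase \<open>- \<i>\<close>.\<close>
  have "exp (\<i> * complex_of_real (pi / 2)) = \<i>"
    by (metis cis_conv_exp cis_pi_half)
  then have "cosh (- (\<i> * complex_of_real (pi / 2))) = 0"
    "sinh (- (\<i> * complex_of_real (pi / 2))) = - \<i>"
    unfolding cosh_def sinh_def minus_minus exp_minus by (simp_all add: scaleR_conv_of_real)
  then have "mat_exp (mat (- (\<i> * complex_of_real (pi / 2))) ** mixer pos job i)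
      = mat (- \<i>) ** mixer pos job i"
    unfolding mat_exp_involution[OF mixer_involution[OF assms]] by (simp add: vec_eq_iff)
  then show ?thesis
    using True unfolding implements_def
    by (intro allI exI[of _ "- \<i>"]) (simp add: mat_mult_vector mixer_basis_state[OF assms])
qed

section \<open>Generating all permutations in layers\<close>

lemma fold_permutes:
  assumes "\<And>x. x \<in> set xs \<Longrightarrow> f x permutes S"
  shows "fold f xs permutes S"
  using assms by (induction xs) (simp_all add: permutes_compose)

abbreviation layer_perm :: "(nat \<Rightarrow> 'j) \<Rightarrow> nat \<Rightarrow> (nat \<Rightarrow> bool) \<Rightarrow> 'j \<Rightarrow> 'j" where
  "layer_perm job N b \<equiv> fold (\<lambda>i. if b i then Transposition.transpose (job i) (job (Suc i)) else id) [1..<N]"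

text \<open>Follow \<open>job a\<close> through the layer: gates below \<open>a\<close> are off,
  each gate \<open>i\<close> from \<open>a\<close> to \<open>n\<close> carries \<open>job i\<close>
  to \<open>job (Suc i)\<close>, and later gates are off. The value is given for every cut-off
  \<open>N\<close> so that induction on \<open>N\<close> works.\<close>

lemma layer_perm_interval:
  assumes "1 \<le> a" "a \<le> Suc n" "1 \<le> N"
  shows "layer_perm job N (\<lambda>i. a \<le> i \<and> i \<le> n) (job a) =
    job (if N \<le> a then a else min N (Suc n))"
  using assms(3)
proof (induction N rule: dec_induct)
  case base
  then show ?case using assms by auto
next
  case (step k)
  consider "k < a" | "k = a" "k \<le> n" | "k = a" "a = Suc n" | "a < k" "k \<le> n" | "a < k" "Suc n \<le> k"
    using assms(2) by linarith
  then show ?case using step assms(1) by cases (auto simp: min_def)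
qed

text \<open>Write \<open>p = q \<circ> c\<close>, where the first layer \<open>c\<close> already
  sends the right job to the last place; \<open>q\<close> then fixes that place and is left to the
  remaining layers. The start \<open>s\<close> is arbitrary because these begin at
  \<open>Suc s\<close>, and \<open>L\<close> may exceed \<open>n\<close> because surplus layers can
  be switched off.\<close>

lemma permutation_by_layers:
  fixes job :: "nat \<Rightarrow> 'j"
  assumes "inj_on job {1..N}"
  shows "n < N \<Longrightarrow> p permutes job ` {1..Suc n} \<Longrightarrow> n \<le> L \<Longrightarrow>
    \<exists>b. fold (\<lambda>k. layer_perm job N (b k)) [s..<s + L] = p"
proof (induction n arbitrary: p L s)
  case 0
  then have "p = id"
    by simp
  moreover have fold_id: "fold (\<lambda>k. id) xs = id" for xs :: "nat list"
    by (induction xs) auto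
  ultimately show ?case
    by (intro exI[of _ "\<lambda>_ _. False"]) (simp only: if_False fold_id)
next
  case (Suc n)
  from Suc.prems obtain L' where L: "L = Suc L'" "n \<le> L'"
    by (cases L) auto
  \<comment> \<open>Take \<open>job a\<close> to be the preimage of the last job under
    \<open>p\<close>; the gates from \<open>a\<close> to \<open>Suc n\<close> send it to the last
    place as well.\<close>
  have "job (Suc (Suc n)) \<in> p ` job ` {1..Suc (Suc n)}"
    using permutes_image[OF Suc.prems(2)] by auto
  then obtain a where a: "a \<in> {1..Suc (Suc n)}" "p (job a) = job (Suc (Suc n))"
    by auto
  define c where "c = layer_perm job N (\<lambda>i. a \<le> i \<and> i \<le> Suc n)"
  have "(if N \<le> a then a else min N (Suc (Suc n))) = Suc (Suc n)"
    using a(1) Suc.prems(1) by auto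
  then have c_a: "c (job a) = job (Suc (Suc n))"
    unfolding c_def using a(1) Suc.prems(1) by (subst layer_perm_interval) auto
  have c_perm: "c permutes job ` {1..Suc (Suc n)}"
    unfolding c_def using a
    by (intro fold_permutes) (auto intro!: permutes_swap_id)
  define q where "q = p \<circ> inv c"
  have qc: "q \<circ> c = p"
    using permutes_inv_o(2)[OF c_perm] by (simp add: q_def comp_assoc)
  have "q permutes job ` {1..Suc n}"
  \<comment> \<open>Both \<open>p\<close> and \<open>c\<close> send \<open>job a\<close> to the last
    job, so \<open>q\<close> fixes the last job.\<close>
  proof (rule permutes_superset)
    show "q permutes job ` {1..Suc (Suc n)}"
      unfolding q_def using c_perm Suc.prems(2) by (intro permutes_compose permutes_inv)
    fix x assume "x \<in> job ` {1..Suc (Suc n)} - job ` {1..Suc n}"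
    then have "x = job (Suc (Suc n))"
      by (auto simp: le_Suc_eq)
    then show "q x = x"
      using qc a(2) c_a by (metis comp_apply)
  qed
  with Suc.IH[of q L' "Suc s"] Suc.prems L obtain b
    where b: "fold (\<lambda>k. layer_perm job N (b k)) [Suc s..<Suc s + L'] = q"
    by auto
  \<comment> \<open>Layer \<open>s\<close> becomes the cycle; the later layers keep the settings
    that produce \<open>q\<close>.\<close>
  define b' where "b' = b(s := (\<lambda>i. a \<le> i \<and> i \<le> Suc n))"
  have "fold (\<lambda>k. layer_perm job N (b' k)) [Suc s..<Suc s + L'] =
      fold (\<lambda>k. layer_perm job N (b k)) [Suc s..<Suc s + L']"
    by (rule ext, rule List.fold_cong) (auto simp: b'_def)
  moreover have "[s..<s + L] = s # [Suc s..<Suc s + L']"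
    by (simp add: L upt_conv_Cons)
  moreover have "layer_perm job N (b' s) = c"
    by (simp add: b'_def c_def)
  ultimately have "fold (\<lambda>k. layer_perm job N (b' k)) [s..<s + L] = p"
    using qc b by simp
  then show ?case by blast
qed

section \<open>Solutions\<close>

lemma sum_of_bool_le_1D:
  fixes P :: "'a::finite \<Rightarrow> bool"
  assumes "(\<Sum>x\<in>UNIV. of_bool (P x)) \<le> (1::nat)" "P x" "P y"
  shows "x = y"
proof -
  have "card {x. P x} \<le> 1"
    using assms(1) by simp
  with assms(2,3) show ?thesis
    by (metis One_nat_def card_le_Suc0_iff_eq finite mem_Collect_eq)
qed

lemma sum_of_bool_eq_1D:
  fixes P :: "'a::finite \<Rightarrow> bool"
  assumes "(\<Sum>x\<in>UNIV. of_bool (P x)) = (1::nat)"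
  obtains x where "\<And>y. P y \<longleftrightarrow> y = x"
proof -
  have "card {x. P x} = 1"
    using assms by simp
  then obtain x where "{x. P x} = {x}"
    by (rule card_1_singletonE)
  then show ?thesis
    by (intro that[of x]) auto
qed

text \<open>The job constraints make \<open>s\<close> a function, the position constraints make it
  injective, and equal cardinalities then make it surjective.\<close>

lemma ossp_solution_bijection:
  fixes z :: "('m::finite, 't::finite, 'j::finite) bits"
  assumes "z \<in> ossp_solutions" "CARD('m) * CARD('t) = CARD('j)"
  obtains s :: "'j \<Rightarrow> 'm \<times> 't" where "bij s" "\<And>m t j. z (m, t, j) \<longleftrightarrow> s j = (m, t)"
proof -
  have "\<exists>r. \<forall>y. z (fst y, snd y, j) \<longleftrightarrow> y = r" for j
  proof -
    have "(\<Sum>y\<in>UNIV. of_bool (z (fst y, snd y, j))) = (1::nat)"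
      using assms(1) by (simp add: ossp_solutions_def sum.cartesian_product case_prod_unfold
          del: sum_of_bool_eq)
    then show ?thesis
      by (rule sum_of_bool_eq_1D) blast
  qed
  then obtain s where s: "\<And>j y. z (fst y, snd y, j) \<longleftrightarrow> y = s j"
    by metis
  have s': "z (m, t, j) \<longleftrightarrow> s j = (m, t)" for m t j
    using s[of "(m, t)" j] by auto
  have "inj s"
  proof (rule injI)
    fix j j' assume "s j = s j'"
    moreover obtain m t where "s j = (m, t)"
      by (cases "s j")
    moreover have "(\<Sum>j\<in>UNIV. of_bool (z (m, t, j))) \<le> (1::nat)"
      using assms(1) by (simp add: ossp_solutions_def)
    ultimately show "j = j'"
      using sum_of_bool_le_1D[of "\<lambda>j. z (m, t, j)"] s' by simp
  qed
  moreover have "CARD('j) = CARD('m \<times> 't)"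
    using assms(2) by simp
  ultimately have "bij s"
    by (simp add: bij_def card_subset_eq card_image)
  with s' show ?thesis
    by (rule that[rotated])
qed

text \<open>With the bijections \<open>s\<close> and \<open>s'\<close> of the two solutions,
  \<open>relabel p\<close> turns \<open>s\<close> into \<open>s \<circ> p\<close>, so
  \<open>p = inv s \<circ> s'\<close> is the witness.\<close>

lemma ossp_solutions_relabel:
  fixes z z' :: "('m::finite, 't::finite, 'j::finite) bits"
  assumes "z \<in> ossp_solutions" "z' \<in> ossp_solutions" "CARD('m) * CARD('t) = CARD('j)"
  obtains p where "p permutes UNIV" "relabel p z = z'"
proof -
  obtain s where s: "bij s" "\<And>m t j. z (m, t, j) \<longleftrightarrow> s j = (m, t)"
    using ossp_solution_bijection assms(1,3) by metis
  obtain s' where s': "bij s'" "\<And>m t j. z' (m, t, j) \<longleftrightarrow> s' j = (m, t)"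
    using ossp_solution_bijection assms(2,3) by metis
  show ?thesis
  proof
    show "inv s \<circ> s' permutes UNIV"
      using s(1) s'(1) by (intro bij_imp_permutes) (auto intro: bij_comp bij_imp_bij_inv)
    show "relabel (inv s \<circ> s') z = z'"
      using s(1) by (auto simp: relabel_def s(2) s'(2) fun_eq_iff surj_f_inv_f bij_is_surj)
  qed
qed

lemma ossp_optimal_nonempty:
  assumes "ossp_solutions \<noteq> ({} :: ('m::finite, 't::finite, 'j::finite) bits set)"
  shows "ossp_optimal \<omega> \<noteq> ({} :: ('m, 't, 'j) bits set)"
proof -
  have "Min (ossp_cost \<omega> ` (ossp_solutions :: ('m, 't, 'j) bits set)) \<in> ossp_cost \<omega> ` ossp_solutions"
    using assms by (intro Min_in) auto
  then obtain z :: "('m, 't, 'j) bits"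
    where "z \<in> ossp_solutions" "Min (ossp_cost \<omega> ` ossp_solutions) = ossp_cost \<omega> z"
    by blast
  then have "z \<in> ossp_optimal \<omega>"
    by (simp add: ossp_optimal_def)
  then show ?thesis by blast
qed

lemma outcome_prob_basis_state:
  assumes "z \<in> Z" "cmod c = 1"
  shows "outcome_prob (c *s basis_state z) Z = 1"
proof -
  have "outcome_prob (c *s basis_state z) Z = (\<Sum>y\<in>Z. if y = z then 1 else 0)"
    unfolding outcome_prob_def using assms(2)
    by (intro sum.cong) (auto simp: basis_state_def axis_def norm_mult)
  then show ?thesis
    using assms(1) by simp
qed

theorem theorem3:
  fixes \<omega> :: "'m::finite \<Rightarrow> 't::finite \<Rightarrow> 'j::finite \<Rightarrow> real"
    and pos :: "nat \<Rightarrow> 'm \<times> 't"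
    and job :: "nat \<Rightarrow> 'j"
    and \<iota> :: "('m, 't, 'j) bits"
  assumes "CARD('m) * CARD('t) = CARD('j)"
    and "bij_betw pos {1..CARD('j)} UNIV"
    and "bij_betw job {1..CARD('j)} UNIV"
    and "\<iota> \<in> ossp_solutions"
  shows "\<exists>\<beta> :: nat \<Rightarrow> nat \<Rightarrow> real.
    (\<forall>k\<in>{1..CARD('j) * (CARD('j) - 1) div 2}. \<forall>i\<in>{1..CARD('j) - 1}. \<beta> k i \<in> {0..pi / 2}) \<and>
    (\<exists>z\<in>ossp_optimal \<omega>. \<exists>c :: complex. cmod c = 1 \<and>
       circuit pos job \<beta> *v basis_state \<iota> = c *s basis_state z) \<and>
    outcome_prob (circuit pos job \<beta> *v basis_state \<iota>) (ossp_optimal \<omega>) = 1"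
proof -
  let ?J = "CARD('j)"
  let ?L = "?J * (?J - 1) div 2"
  obtain z :: "('m, 't, 'j) bits" where z: "z \<in> ossp_optimal \<omega>"
    using ossp_optimal_nonempty assms(4) by blast
  then have "z \<in> ossp_solutions"
    by (simp add: ossp_optimal_def)
  then obtain p where p: "p permutes UNIV" "relabel p \<iota> = z"
    using ossp_solutions_relabel assms(1,4) by metis
  have "?J > 0"
    by simp
  then obtain n where n: "?J = Suc n"
    using gr0_implies_Suc by blast
  \<comment> \<open>With \<open>J = n + 1\<close> there are \<open>n * (n + 1) / 2\<close> layers,
    which is at least \<open>n\<close>: either \<open>n = 0\<close> or \<open>n + 1\<close> is at
    least 2.\<close>
  have "n \<le> ?L"
    unfolding n by (cases n) auto
  moreover have "job ` {1..Suc n} = UNIV" "inj_on job {1..Suc n}"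
    using assms(3) n by (simp_all add: bij_betw_def)
  ultimately obtain b where b: "fold (\<lambda>k. layer_perm job ?J (b k)) [1..<1 + ?L] = p"
    using permutation_by_layers[of job ?J n p ?L 1] p(1) n by auto
  \<comment> \<open>Only the two endpoints of the parameter interval are used: gate off or gate
    on.\<close>
  define \<beta> where "\<beta> = (\<lambda>k i. if b k i then pi / 2 else 0)"
  have "implements (circuit pos job \<beta>) p"
    \<comment> \<open>The commutation rewrites the upper bound \<open>?L + 1\<close> of the circuit
      as \<open>1 + ?L\<close>, the form \<open>s + L\<close> with \<open>s = 1\<close>.\<close>
    unfolding circuit_def b[symmetric] \<beta>_def add.commute[of _ 1]
    by (intro implements_mat_prod implements_gate assms(2))
  then obtain c where c: "cmod c = 1" "circuit pos job \<beta> *v basis_state \<iota> = c *s basis_state z"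
    unfolding implements_def p(2)[symmetric] by blast
  moreover have "\<beta> k i \<in> {0..pi / 2}" for k i
    by (simp add: \<beta>_def)
  ultimately show ?thesis
    using z outcome_prob_basis_state[OF z] by (intro exI[of _ \<beta>]) auto
qed

end
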